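(* Let $A=RB:I\to\mathbb{R}^{3\times6}$ be smooth on an open interval $I$, with $R(t)\in SO(3)$, $$B=\begin{pmatrix}b_{11}&b_{12}&\ell_1b_{11}+\ell_2b_{12}&-\ell_2b_{11}+\ell_1b_{12}&\ell_1b_{15}&-\ell_2b_{15}\\0&b_{22}&\ell_2b_{22}&\ell_1b_{22}&\ell_1b_{25}&-\ell_2b_{25}\\0&0&0&0&\ell_1b_{35}&-\ell_2b_{35}\end{pmatrix},$$ $$b_{11}b_{22}b_{35}(\ell_1^2+\ell_2^2)+1=0,\qquad \ell_1=1+\cos\theta,\quad \ell_2=\sin\theta,\qquad \theta'b_{11}b_{22}=\gamma,$$ where $\gamma\ne0$ is a constant. Suppose that $Q_{12},Q_{13},Q_{14},Q_{23},Q_{24},Q_{35},Q_{36},Q_{45},Q_{46},Q_{56}$ are constant, $Q_{ij}=c_{ij}$, that $Q_{15}-Q_{26}$ and $Q_{16}+Q_{25}$ are constant, that $c_{12}\ne0$, and that $(c_{36},c_{46})\neq(0,0)$. Then there are constants $m_0,m_1$ with $$(c_{36}^2+c_{46}^2)\gamma^2+4c_{12}(c_{46}m_0+c_{36}m_1)+4m_0^2+4m_1^2=0$$ (in particular $c_{36}m_1+c_{46}m_0\neq0$) such that $$b_{15}=\frac{c_{36}\sin\theta-c_{46}(1-\cos\theta)}{2\gamma\sin\theta}\,b_{22},\qquad b_{25}=\frac{m_1\sin\theta+m_0(1+\cos\theta)}{\gamma^2(1+\cos\theta)}\,b_{22},$$ $$(\theta')^3=4\big(c_{56}\gamma^2-c_{36}m_1-c_{46}m_0\big)(1+\cos\theta),\qquad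 b_{35}=-\frac{\theta'}{2\gamma(1+\cos\theta)},$$ $$b_{11}^2=\frac{(m_2-m_3)\cos\theta-2m_4\sin\theta+m_2+m_3}{4\theta'},\qquad b_{12}=\frac{(m_2-m_3)\sin\theta+2m_4\cos\theta}{4b_{11}\theta'},$$ $$b_{22}=\frac{\gamma}{b_{11}\theta'},\qquad w_1=w_2=0,\qquad w_3=-\frac{\gamma}{b_{11}^2},$$ where $$m_2=\frac{\gamma^2c_{36}^2+4m_0^2}{c_{36}m_1+c_{46}m_0},\qquad m_3=\frac{\gamma^2c_{46}^2+4m_1^2}{c_{36}m_1+c_{46}m_0},\qquad m_4=\frac{\gamma^2c_{36}c_{46}-4m_0m_1}{c_{36}m_1+c_{46}m_0}.$$ (At points where $\sin\theta=0$, $\cos\theta=1$, the formula for $b_{15}$ is understood by continuity.)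
   Context: For $A(t)\in\mathbb{R}^{3\times m}$ with columns $A_i$, $Q_{ij}=\langle A_i',A_j\rangle-\langle A_j',A_i\rangle$, $'=d/dt$. For smooth $R(t)\in SO(3)$ the vector $w=(w_1,w_2,w_3)$ is defined by $R^TR'x=\tfrac12\,w\times x$ for all $x\in\mathbb{R}^3$. Origin: $\varphi(z,t)=A(t)v(z)$ is sought as a solution of the 3D incompressible Euler equations in Lagrangian form with $v=(z_1,z_2,z_3,f^1(z_3),f^2(z_1,z_2),f^3(z_1,z_2))$, where $\partial_{z_1}f^2+\partial_{z_2}f^3=0$, $\partial_{z_2}f^2-\partial_{z_1}f^3=0$ (elliptic case, $m=6$). The form $$B=\begin{pmatrix}b_{11}&b_{12}&\ell_1b_{11}+\ell_2b_{12}&-\ell_2b_{11}+\ell_1b_{12}&\ell_1b_{15}&-\ell_2b_{15}\\0&b_{22}&\ell_2b_{22}&\ell_1b_{22}&\ell_1b_{25}&-\ell_2b_{25}\\0&0&0&0&\ell_1b_{35}&-\ell_2b_{35}\end{pmatrix},\qquad b_{11}b_{22}b_{35}(\ell_1^2+\ell_2^2)+1=0,$$ is the one for which the minors $p_{ijk}=\det(A_i,A_j,A_k)$ satisfy $p_{123}=p_{356}=p_{124}=p_{456}=0$, $p_{135}-p_{236}=p_{146}+p_{245}=0$, $p_{136}+p_{235}=-p_{145}+p_{246}=1$. The form of $\ell_1,\ell_2$ (unit circle centered at $(k,0)$, here $k=1$) and the relation $\theta'b_{11}b_{22}=\gamma$, with $\gamma^2=c_{12}^2-(c_{12}-c_{14})^2-c_{13}^2$,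 are the normalized form ($k_0=1$, $k_1=k=1$, $k_2=0$) of the following fact: the constancy of $Q_{12},Q_{13},Q_{14},Q_{23},Q_{24}$ yields a function $\theta$ and constants $k_0,k_1,k_2,\gamma$ with $\ell_1=k_1+k_0\cos\theta$, $\ell_2=k_2+k_0\sin\theta$, $\theta'b_{11}b_{22}=\gamma$, $\gamma^2=c_{12}^2k_0^2-(c_{12}k_1-c_{14})^2-(c_{12}k_2-c_{13})^2$. *)

theory Defs
  imports "HOL-Analysis.Analysis"
begin

text \<open>Smoothness of a curve, meant for open \<open>S\<close>: every iterated derivative of \<open>f\<close>
  (including \<open>f\<close> itself) is differentiable at each point of \<open>S\<close>.\<close>

definition smooth_curve_on :: "real set \<Rightarrow> (real \<Rightarrow> 'a::real_normed_vector) \<Rightarrow> bool" where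
  "smooth_curve_on S f \<longleftrightarrow>
     (\<forall>k. \<forall>t\<in>S. ((\<lambda>g s. vector_derivative g (at s)) ^^ k) f differentiable (at t))"

definition Q :: "(real \<Rightarrow> real^'m^3) \<Rightarrow> 'm \<Rightarrow> 'm \<Rightarrow> real \<Rightarrow> real" where
  "Q A i j t =
     vector_derivative (\<lambda>s. column i (A s)) (at t) \<bullet> column j (A t) -
     vector_derivative (\<lambda>s. column j (A s)) (at t) \<bullet> column i (A t)"

text \<open>For a differentiable curve \<open>R\<close> of rotations, \<open>R\<^sup>T R'\<close> is skew-symmetric,
  so the vector described here exists and is unique.\<close>

definition rot_vec :: "(real \<Rightarrow> real^3^3) \<Rightarrow> real \<Rightarrow> real^3" where
  "rot_vec R t =
     (THE w. \<forall>x. (transpose (R t) ** vector_derivative R (at t)) *v x = (1/2) *\<^sub>R cross3 w x)"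

text \<open>In the index type \<open>6\<close> the numeral \<open>6\<close> equals \<open>0\<close>; it denotes the last column,
  since \<^const>\<open>vector\<close> enumerates the indices as \<open>1, 2, \<dots>, 6\<close>.\<close>

definition B_form ::
  "real \<Rightarrow> real \<Rightarrow> real \<Rightarrow> real \<Rightarrow> real \<Rightarrow> real \<Rightarrow> real \<Rightarrow> real \<Rightarrow> real^6^3" where
  "B_form b11 b12 b22 b15 b25 b35 l1 l2 = vector
     [vector [b11, b12, l1*b11 + l2*b12, - l2*b11 + l1*b12, l1*b15, - l2*b15],
      vector [0,   b22, l2*b22,          l1*b22,            l1*b25, - l2*b25],
      vector [0,   0,   0,               0,                 l1*b35, - l2*b35]]"

end

theory Submission
  imports Defs
begin

text \<open>
  In the moving frame \<open>R\<close> each \<open>Q\<^sub>i\<^sub>j\<close> is a skew bilinear expression in the columns of \<open>B\<close> and their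
  derivatives, plus the triple product of the rotation vector \<open>w\<close> with the two columns
  (\<open>Q_moving_frame\<close>). The six columns are built from three vectors \<open>X\<close>, \<open>Y\<close>, \<open>U\<close>, so all
  conditions involve only three pairings \<open>q12\<close>, \<open>q1\<close>, \<open>q2\<close> and the inner products of \<open>X\<close>, \<open>Y\<close>,
  \<open>U\<close> (\<open>Q_B_form\<close>). In the pairings, which absorb \<open>w\<close> and the derivatives of the entries, and in
  the inner products multiplied by \<open>\<theta>'\<close>, the conditions are linear equations whose coefficients
  are polynomials in \<open>cos \<theta>\<close> and \<open>sin \<theta>\<close>:

  \<^item> \<open>Q\<^sub>1\<^sub>3\<close>, \<open>Q\<^sub>1\<^sub>4\<close> give \<open>\<theta>' |X|\<^sup>2 = P\<close> and \<open>\<theta>' \<langle>X, Y\<rangle> = - D\<close>, where \<open>P = a cos \<theta> + s sin \<theta> - c\<^sub>1\<^sub>2\<close>,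
    \<open>D = s cos \<theta> - a sin \<theta>\<close>, \<open>a = c\<^sub>1\<^sub>4 - c\<^sub>1\<^sub>2\<close>, \<open>s = c\<^sub>1\<^sub>3\<close>. Together with \<open>Q\<^sub>2\<^sub>3\<close>, \<open>Q\<^sub>2\<^sub>4\<close> and
    \<open>\<theta>' b11 b22 = \<gamma>\<close> the Gram determinant of the plane yields \<open>\<gamma>\<^sup>2 = c\<^sub>1\<^sub>2\<^sup>2 - a\<^sup>2 - s\<^sup>2\<close>.
  \<^item> \<open>Q\<^sub>3\<^sub>5\<close>, \<open>Q\<^sub>3\<^sub>6\<close>, \<open>Q\<^sub>4\<^sub>5\<close>, \<open>Q\<^sub>4\<^sub>6\<close> determine \<open>q1\<close>, \<open>q2\<close>, \<open>\<langle>X, U\<rangle>\<close>, \<open>\<langle>Y, U\<rangle>\<close>. Constancy of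
    \<open>Q\<^sub>1\<^sub>5 - Q\<^sub>2\<^sub>6\<close> is then a trigonometric identity along the curve, and \<open>\<theta>' \<noteq> 0\<close> makes its
    coefficients vanish; this forces \<open>c\<^sub>3\<^sub>5 = c\<^sub>4\<^sub>5 = 0\<close>.

  The entries of \<open>B\<close> follow from the Gram products (\<open>B_form_solution\<close>). The constants \<open>m0\<close>, \<open>m1\<close>
  are the coefficients of \<open>b25\<close> as an affine function of \<open>tan (\<theta>/2)\<close>. They are affine in \<open>a\<close> and
  \<open>s\<close>, and \<open>m_identities\<close> inverts this relation: the quotients \<open>m2\<close>, \<open>m3\<close>, \<open>m4\<close> are just
  \<open>2 (a - c\<^sub>1\<^sub>2)\<close>, \<open>- 2 (a + c\<^sub>1\<^sub>2)\<close>, \<open>- 2 s\<close>. Adding the first two identities gives the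
  quadratic relation for \<open>m0\<close>, \<open>m1\<close>. Its term \<open>(c\<^sub>3\<^sub>6\<^sup>2 + c\<^sub>4\<^sub>6\<^sup>2) \<gamma>\<^sup>2\<close> is positive,
  so the only term without a sign cannot vanish, that is, \<open>c\<^sub>3\<^sub>6 m1 + c\<^sub>4\<^sub>6 m0 \<noteq> 0\<close>.

  Finally all ratios \<open>b12/b11\<close>, \<open>b15/b11\<close>, \<open>b25/b22\<close> are explicit functions of \<open>\<theta>\<close>, so their
  derivatives are known, and the pairings \<open>q12\<close>, \<open>q1\<close>, \<open>q2\<close>, already determined, can be solved for
  \<open>w\<close> (\<open>rotation_of_B_form_solution\<close>).
\<close>

section \<open>The skew forms in the moving frame\<close>

text \<open>For curves \<open>R X\<close> and \<open>R Y\<close> with \<open>R\<close> a rotation, \<open>(R X)' = R (X' + w \<times> X / 2)\<close>. The two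
  rotational halves in \<open>\<langle>(RX)', RY\<rangle> - \<langle>(RY)', RX\<rangle>\<close> add up to one triple product, which leaves the
  expression below; the derivatives are separate arguments so that it can be treated as a
  bilinear skew form in the pairs \<open>(X, X')\<close> and \<open>(Y, Y')\<close>.\<close>
definition frame_Q :: "real^3 \<Rightarrow> real^3 \<Rightarrow> real^3 \<Rightarrow> real^3 \<Rightarrow> real^3 \<Rightarrow> real" where
  "frame_Q w X X' Y Y' = w \<bullet> cross3 X Y + X' \<bullet> Y - Y' \<bullet> X"

lemma frame_Q_self [simp]: "frame_Q w X X' X X' = 0"
  by (simp add: frame_Q_def)

lemma frame_Q_add_left:
  "frame_Q w (X + Z) (X' + Z') Y Y' = frame_Q w X X' Y Y' + frame_Q w Z Z' Y Y'"
  by (simp add: frame_Q_def cross_add_left inner_add_left inner_add_right)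

lemma frame_Q_add_right:
  "frame_Q w Y Y' (X + Z) (X' + Z') = frame_Q w Y Y' X X' + frame_Q w Y Y' Z Z'"
  by (simp add: frame_Q_def cross_add_right inner_add_left inner_add_right)

text \<open>The form is not linear over functions: by the Leibniz rule a scalar factor contributes its
  derivative times the inner product. All dependence on \<open>l1'\<close> and \<open>l2'\<close> below comes from here.\<close>
lemma frame_Q_scaleR_left:
  "frame_Q w (f *\<^sub>R X) (f *\<^sub>R X' + f' *\<^sub>R X) Y Y' = f * frame_Q w X X' Y Y' + f' * (X \<bullet> Y)"
  by (simp add: frame_Q_def cross_mult_left inner_add_left algebra_simps)

lemma frame_Q_scaleR_right:
  "frame_Q w X X' (g *\<^sub>R Y) (g *\<^sub>R Y' + g' *\<^sub>R Y) = g * frame_Q w X X' Y Y' - g' * (X \<bullet> Y)"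
  by (simp add: frame_Q_def cross_mult_right inner_add_left inner_commute algebra_simps)

lemma bounded_bilinear_matrix_vector_mult:
  "bounded_bilinear ((*v) :: real^'n^'m \<Rightarrow> real^'n \<Rightarrow> real^'m)"
  unfolding bilinear_conv_bounded_bilinear[symmetric] bilinear_def
  by (auto intro!: linearI simp: matrix_vector_mult_add_rdistrib matrix_vector_right_distrib
      scaleR_matrix_vector_assoc matrix_vector_mult_scaleR)

lemma bounded_bilinear_matrix_matrix_mult:
  "bounded_bilinear ((**) :: real^'n^'m \<Rightarrow> real^'k^'n \<Rightarrow> real^'k^'m)"
  unfolding bilinear_conv_bounded_bilinear[symmetric] bilinear_def
  by (intro conjI allI; rule linearI)
    (simp_all add: matrix_matrix_mult_def vec_eq_iff sum.distrib distrib_left distrib_right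
      sum_distrib_left mult.left_commute mult.assoc)

lemma bounded_linear_transpose: "bounded_linear (transpose :: real^'n^'m \<Rightarrow> real^'m^'n)"
  unfolding linear_conv_bounded_linear[symmetric]
  by (rule linearI) (simp_all add: transpose_def vec_eq_iff)

lemma column_matrix_mult: "column i (M ** N) = M *v column i N"
  by (simp add: column_def matrix_matrix_mult_def matrix_vector_mult_def vec_eq_iff)

lemma skew_matrix_cross3:
  fixes M :: "real^3^3"
  assumes "transpose M = - M"
  shows "M *v x = cross3 (vector [M$3$2, M$1$3, M$2$1]) x"
proof -
  have skew: "M$j$i = - M$i$j" for i j
    using arg_cong[OF assms, of "\<lambda>N. N$i$j"] by (simp add: transpose_def)
  have "M$1$1 = 0" "M$2$2 = 0" "M$3$3 = 0"
    using skew[of 1 1] skew[of 2 2] skew[of 3 3] by linarith+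
  moreover note skew[of 2 1] skew[of 1 3] skew[of 3 2]
  ultimately show ?thesis
    by (simp add: matrix_vector_mult_def cross3_def vec_eq_iff forall_3 sum_3)
qed

text \<open>Differentiate \<open>R\<^sup>T R = 1\<close>.\<close>
lemma transpose_mult_derivative_skew:
  fixes R :: "real \<Rightarrow> real^'n^'n"
  assumes R: "(R has_vector_derivative R') (at t)"
    and orth: "\<forall>\<^sub>F s in nhds t. orthogonal_matrix (R s)"
  shows "transpose (transpose (R t) ** R') = - (transpose (R t) ** R')"
proof -
  have "((\<lambda>s. transpose (R s) ** R s) has_vector_derivative
      (transpose (R t) ** R' + transpose R' ** R t)) (at t)"
    by (rule bounded_bilinear.has_vector_derivative[OF bounded_bilinear_matrix_matrix_mult
          bounded_linear.has_vector_derivative[OF bounded_linear_transpose R] R])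
  moreover have "((\<lambda>s. transpose (R s) ** R s) has_vector_derivative 0) (at t)"
  proof -
    from orth obtain U where U: "open U" "t \<in> U" "\<And>s. s \<in> U \<Longrightarrow> orthogonal_matrix (R s)"
      unfolding eventually_nhds by blast
    show ?thesis
      by (rule has_vector_derivative_transform_within_open[OF has_vector_derivative_const U(1,2)])
        (use U(3) in \<open>simp add: orthogonal_matrix\<close>)
  qed
  ultimately have "transpose (R t) ** R' + transpose R' ** R t = 0"
    by (rule vector_derivative_unique_at)
  then show ?thesis
    by (simp add: matrix_transpose_mul add_eq_0_iff)
qed

text \<open>A skew matrix acts as a cross product, which gives existence of the vector; testing on two
  basis vectors gives uniqueness, so the definite description in \<open>rot_vec\<close> is meaningful.\<close>
lemma rot_vec_cross3:
  fixes R :: "real \<Rightarrow> real^3^3"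
  assumes R: "(R has_vector_derivative R') (at t)"
    and orth: "\<forall>\<^sub>F s in nhds t. orthogonal_matrix (R s)"
  shows "(transpose (R t) ** R') *v x = (1/2) *\<^sub>R cross3 (rot_vec R t) x"
proof -
  let ?M = "transpose (R t) ** R'"
  let ?P = "\<lambda>w. \<forall>x. ?M *v x = (1/2) *\<^sub>R cross3 w x"
  obtain v where v: "\<And>x. ?M *v x = cross3 v x"
    using skew_matrix_cross3[OF transpose_mult_derivative_skew[OF R orth]] by blast
  have "?P (2 *\<^sub>R v)"
    by (simp add: v cross_mult_left)
  moreover have "w = 2 *\<^sub>R v" if "?P w" for w
  proof -
    have "cross3 w x = 2 *\<^sub>R cross3 v x" for x
    proof -
      have "(1/2) *\<^sub>R cross3 w x = cross3 v x"
        using that[rule_format, of x] v[of x] by (rule trans[OF sym])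
      then have "2 *\<^sub>R ((1/2) *\<^sub>R cross3 w x) = 2 *\<^sub>R cross3 v x"
        by (rule arg_cong)
      then show ?thesis by simp
    qed
    from this[of "axis 1 1"] this[of "axis 2 1"] show ?thesis
      by (simp add: cross3_def axis_def vec_eq_iff forall_3)
  qed
  ultimately have "?P (THE w. ?P w)"
    by (rule theI[of ?P])
  then show ?thesis
    unfolding rot_vec_def vector_derivative_at[OF R] by (rule spec)
qed

lemma Q_moving_frame:
  fixes R :: "real \<Rightarrow> real^3^3" and A :: "real \<Rightarrow> real^'m^3"
  assumes R: "(R has_vector_derivative R') (at t)"
    and U: "open U" "t \<in> U" and orth: "\<And>s. s \<in> U \<Longrightarrow> orthogonal_matrix (R s)"
    and X: "\<And>s. s \<in> U \<Longrightarrow> column i (A s) = R s *v X s" "(X has_vector_derivative X') (at t)"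
    and Y: "\<And>s. s \<in> U \<Longrightarrow> column j (A s) = R s *v Y s" "(Y has_vector_derivative Y') (at t)"
  shows "Q A i j t = frame_Q (rot_vec R t) (X t) X' (Y t) Y'"
proof -
  have orth': "\<forall>\<^sub>F s in nhds t. orthogonal_matrix (R s)"
    using U orth unfolding eventually_nhds by blast
  have der: "vector_derivative (\<lambda>s. column k (A s)) (at t) = R t *v Z' + R' *v Z t"
    if "\<And>s. s \<in> U \<Longrightarrow> column k (A s) = R s *v Z s" "(Z has_vector_derivative Z') (at t)"
    for k Z Z'
  proof (rule vector_derivative_at, rule has_vector_derivative_transform_within_open[OF _ U])
    show "((\<lambda>s. R s *v Z s) has_vector_derivative R t *v Z' + R' *v Z t) (at t)"
      by (rule bounded_bilinear.has_vector_derivative[OF bounded_bilinear_matrix_vector_mult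
            R that(2)])
  qed (simp add: that(1))
  have inner: "(R t *v Z' + R' *v Z) \<bullet> (R t *v W) = Z' \<bullet> W + (1/2) * (cross3 (rot_vec R t) Z \<bullet> W)"
    for Z Z' W
  proof -
    have "(R t *v Z' + R' *v Z) \<bullet> (R t *v W) = (transpose (R t) *v (R t *v Z' + R' *v Z)) \<bullet> W"
      by (metis dot_lmul_matrix inner_commute transpose_matrix_vector)
    also have "transpose (R t) *v (R t *v Z' + R' *v Z) = Z' + (transpose (R t) ** R') *v Z"
      using orth[OF U(2)]
      by (simp add: matrix_vector_right_distrib matrix_vector_mul_assoc orthogonal_matrix)
    finally show ?thesis
      by (simp add: rot_vec_cross3[OF R orth'] inner_add_left)
  qed
  have "cross3 (rot_vec R t) (X t) \<bullet> Y t = rot_vec R t \<bullet> cross3 (X t) (Y t)"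
    "cross3 (rot_vec R t) (Y t) \<bullet> X t = - (rot_vec R t \<bullet> cross3 (X t) (Y t))"
    by (simp_all add: cross3_simps)
  then show ?thesis
    by (simp add: Q_def der[of i X X', OF X] der[of j Y Y', OF Y] X(1)[OF U(2)] Y(1)[OF U(2)]
        inner frame_Q_def)
qed

lemma B_form_columns:
  fixes b11 b12 b22 b15 b25 b35 l1 l2 :: real
  defines "B \<equiv> B_form b11 b12 b22 b15 b25 b35 l1 l2"
    and "X \<equiv> vector [b11, 0, 0] :: real^3" and "Y \<equiv> vector [b12, b22, 0] :: real^3"
    and "U \<equiv> vector [b15, b25, b35] :: real^3"
  shows "column 1 B = X" "column 2 B = Y" "column 3 B = l1 *\<^sub>R X + l2 *\<^sub>R Y"
    "column 4 B = - l2 *\<^sub>R X + l1 *\<^sub>R Y" "column 5 B = l1 *\<^sub>R U" "column 6 B = - l2 *\<^sub>R U"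
  by (simp_all add: assms column_def B_form_def vec_eq_iff forall_3) (simp_all add: vector_def)

lemma has_vector_derivative_vector_3:
  assumes "(f has_real_derivative f') (at t)" "(g has_real_derivative g') (at t)"
    "(k has_real_derivative k') (at t)"
  shows "((\<lambda>s. vector [f s, g s, k s] :: real^3) has_vector_derivative vector [f', g', k']) (at t)"
proof -
  have eq: "vector [x, y, z] = x *\<^sub>R axis 1 1 + y *\<^sub>R axis 2 1 + z *\<^sub>R (axis 3 1 :: real^3)"
    for x y z :: real
    by (simp add: vec_eq_iff forall_3 axis_def)
  show ?thesis
    unfolding eq using assms
    by (auto intro!: derivative_eq_intros simp: has_real_derivative_iff_has_vector_derivative)
qed

text \<open>The columns of the normal form are combinations of only three vectors
  \<open>X = (b11, 0, 0)\<close>, \<open>Y = (b12, b22, 0)\<close>, \<open>U = (b15, b25, b35)\<close> with coefficients \<open>l1\<close>, \<open>l2\<close>: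
  columns 3 and 4 are \<open>X\<close>, \<open>Y\<close> turned and stretched by \<open>(l1, l2)\<close>, columns 5 and 6 are multiples
  of \<open>U\<close>. Hence every \<open>Q\<^sub>i\<^sub>j\<close> is expressed by the three pairings \<open>q12\<close>, \<open>q1\<close>, \<open>q2\<close> and the inner
  products of \<open>X\<close>, \<open>Y\<close>, \<open>U\<close>. The rotation vector enters through the pairings alone, so
  the remaining equations can be solved without knowing it.\<close>
lemma Q_B_form:
  fixes R :: "real \<Rightarrow> real^3^3" and A :: "real \<Rightarrow> real^6^3"
    and b11 b12 b22 b15 b25 b35 l1 l2 :: "real \<Rightarrow> real"
  defines "w \<equiv> rot_vec R"
  assumes R: "(R has_vector_derivative R') (at t)"
    and I: "open I" "t \<in> I" and orth: "\<forall>s\<in>I. orthogonal_matrix (R s)"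
    and A: "\<forall>s\<in>I. A s = R s **
           B_form (b11 s) (b12 s) (b22 s) (b15 s) (b25 s) (b35 s) (l1 s) (l2 s)"
    and b: "(b11 has_real_derivative b11') (at t)" "(b12 has_real_derivative b12') (at t)"
      "(b22 has_real_derivative b22') (at t)" "(b15 has_real_derivative b15') (at t)"
      "(b25 has_real_derivative b25') (at t)" "(b35 has_real_derivative b35') (at t)"
    and l: "(l1 has_real_derivative l1') (at t)" "(l2 has_real_derivative l2') (at t)"
  defines "q12 \<equiv> w t $ 3 * b11 t * b22 t + b11' * b12 t - b12' * b11 t"
    and "q1 \<equiv> - w t $ 2 * b11 t * b35 t + w t $ 3 * b11 t * b25 t + b11' * b15 t - b15' * b11 t"
    and "q2 \<equiv> w t $ 1 * b22 t * b35 t - w t $ 2 * b12 t * b35 t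
          + w t $ 3 * (b12 t * b25 t - b22 t * b15 t)
          + b12' * b15 t - b15' * b12 t + b22' * b25 t - b25' * b22 t"
    and "g11 \<equiv> (b11 t)^2" and "g12 \<equiv> b11 t * b12 t" and "g22 \<equiv> (b12 t)^2 + (b22 t)^2"
    and "g1 \<equiv> b11 t * b15 t" and "g2 \<equiv> b12 t * b15 t + b22 t * b25 t"
    and "g \<equiv> (b15 t)^2 + (b25 t)^2 + (b35 t)^2"
  shows "Q A 1 2 t = q12"
    "Q A 1 3 t = l2 t * q12 - l1' * g11 - l2' * g12"
    "Q A 1 4 t = l1 t * q12 + l2' * g11 - l1' * g12"
    "Q A 2 3 t = - l1 t * q12 - l1' * g12 - l2' * g22"
    "Q A 2 4 t = l2 t * q12 + l2' * g12 - l1' * g22"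
    "Q A 1 5 t = l1 t * q1 - l1' * g1"
    "Q A 2 6 t = - l2 t * q2 + l2' * g2"
    "Q A 3 5 t = l1 t * (l1 t * q1 + l2 t * q2) + (l1 t * l2' - l2 t * l1') * g2"
    "Q A 3 6 t = - l2 t * (l1 t * q1 + l2 t * q2) + (l1 t * l2' - l2 t * l1') * g1"
    "Q A 4 5 t = l1 t * (l1 t * q2 - l2 t * q1) - (l1 t * l2' - l2 t * l1') * g1"
    "Q A 4 6 t = - l2 t * (l1 t * q2 - l2 t * q1) + (l1 t * l2' - l2 t * l1') * g2"
    "Q A 5 6 t = (l1 t * l2' - l2 t * l1') * g"
proof -
  note orth = orth[rule_format] and A = A[rule_format]
  define X where "X = (\<lambda>s. vector [b11 s, 0, 0] :: real^3)"
  define Y where "Y = (\<lambda>s. vector [b12 s, b22 s, 0] :: real^3)"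
  define U where "U = (\<lambda>s. vector [b15 s, b25 s, b35 s] :: real^3)"
  define X' Y' U' where "X' = (vector [b11', 0, 0] :: real^3)"
    and "Y' = (vector [b12', b22', 0] :: real^3)" and "U' = (vector [b15', b25', b35'] :: real^3)"
  have X: "(X has_vector_derivative X') (at t)"
    and Y: "(Y has_vector_derivative Y') (at t)"
    and U: "(U has_vector_derivative U') (at t)"
    unfolding X_def Y_def U_def X'_def Y'_def U'_def
    by (intro has_vector_derivative_vector_3 b DERIV_const)+
  have scale: "((\<lambda>s. f s *\<^sub>R Z s) has_vector_derivative f t *\<^sub>R Z' + f' *\<^sub>R Z t) (at t)"
    if "(f has_real_derivative f') (at t)" "(Z has_vector_derivative Z') (at t)"
    for f f' and Z :: "real \<Rightarrow> real^3" and Z'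
    using has_vector_derivative_scaleR[OF that] .
  note ml2 = DERIV_minus[OF l(2)]
  have col: "column 1 (A s) = R s *v X s" "column 2 (A s) = R s *v Y s"
    "column 3 (A s) = R s *v (l1 s *\<^sub>R X s + l2 s *\<^sub>R Y s)"
    "column 4 (A s) = R s *v (- l2 s *\<^sub>R X s + l1 s *\<^sub>R Y s)"
    "column 5 (A s) = R s *v (l1 s *\<^sub>R U s)"
    "column 6 (A s) = R s *v (- l2 s *\<^sub>R U s)" if "s \<in> I" for s
    by (simp_all only: A[OF that] column_matrix_mult B_form_columns X_def Y_def U_def)
  note der3 = has_vector_derivative_add[OF scale[OF l(1) X] scale[OF l(2) Y]]
  note der4 = has_vector_derivative_add[OF scale[OF ml2 X] scale[OF l(1) Y]]
  note der5 = scale[OF l(1) U] and der6 = scale[OF ml2 U]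
  note moving = Q_moving_frame[OF R I orth]
  note expand = frame_Q_add_left frame_Q_add_right frame_Q_scaleR_left frame_Q_scaleR_right
    inner_add_left inner_add_right
  let ?F = "frame_Q (w t)"
  have q: "?F (X t) X' (Y t) Y' = q12" "?F (Y t) Y' (X t) X' = - q12"
    "?F (X t) X' (U t) U' = q1" "?F (Y t) Y' (U t) U' = q2"
    by (simp_all add: frame_Q_def q12_def q1_def q2_def X_def Y_def U_def X'_def Y'_def U'_def
        cross3_def inner_vec_def sum_3 algebra_simps)
  have g: "X t \<bullet> X t = g11" "X t \<bullet> Y t = g12" "Y t \<bullet> X t = g12" "Y t \<bullet> Y t = g22"
    "X t \<bullet> U t = g1" "Y t \<bullet> U t = g2" "U t \<bullet> U t = g"
    by (simp_all add: g11_def g12_def g22_def g1_def g2_def g_def X_def Y_def U_def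
        inner_vec_def sum_3 power2_eq_square algebra_simps)
  show "Q A 1 2 t = q12"
    using moving[of 1 A X X' 2 Y Y', OF _ col(1) X col(2) Y] q by (simp add: w_def)
  note fold = w_def[symmetric] expand q g frame_Q_self
  show "Q A 1 3 t = l2 t * q12 - l1' * g11 - l2' * g12"
    by (subst moving[OF _ col(1) X col(3) der3])
      (simp_all only: fold inner_simps, (simp_all add: algebra_simps)?)
  show "Q A 1 4 t = l1 t * q12 + l2' * g11 - l1' * g12"
    by (subst moving[OF _ col(1) X col(4) der4])
      (simp_all only: fold inner_simps, (simp_all add: algebra_simps)?)
  show "Q A 2 3 t = - l1 t * q12 - l1' * g12 - l2' * g22"
    by (subst moving[OF _ col(2) Y col(3) der3])
      (simp_all only: fold inner_simps, (simp_all add: algebra_simps)?)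
  show "Q A 2 4 t = l2 t * q12 + l2' * g12 - l1' * g22"
    by (subst moving[OF _ col(2) Y col(4) der4])
      (simp_all only: fold inner_simps, (simp_all add: algebra_simps)?)
  show "Q A 1 5 t = l1 t * q1 - l1' * g1"
    by (subst moving[OF _ col(1) X col(5) der5])
      (simp_all only: fold inner_simps, (simp_all add: algebra_simps)?)
  show "Q A 2 6 t = - l2 t * q2 + l2' * g2"
    by (subst moving[OF _ col(2) Y col(6) der6])
      (simp_all only: fold inner_simps, (simp_all add: algebra_simps)?)
  show "Q A 3 5 t = l1 t * (l1 t * q1 + l2 t * q2) + (l1 t * l2' - l2 t * l1') * g2"
    by (subst moving[OF _ col(3) der3 col(5) der5])
      (simp_all only: fold inner_simps, (simp_all add: algebra_simps)?)
  show "Q A 3 6 t = - l2 t * (l1 t * q1 + l2 t * q2) + (l1 t * l2' - l2 t * l1') * g1"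
    by (subst moving[OF _ col(3) der3 col(6) der6])
      (simp_all only: fold inner_simps, (simp_all add: algebra_simps)?)
  show "Q A 4 5 t = l1 t * (l1 t * q2 - l2 t * q1) - (l1 t * l2' - l2 t * l1') * g1"
    by (subst moving[OF _ col(4) der4 col(5) der5])
      (simp_all only: fold inner_simps, (simp_all add: algebra_simps)?)
  show "Q A 4 6 t = - l2 t * (l1 t * q2 - l2 t * q1) + (l1 t * l2' - l2 t * l1') * g2"
    by (subst moving[OF _ col(4) der4 col(6) der6])
      (simp_all only: fold inner_simps, (simp_all add: algebra_simps)?)
  show "Q A 5 6 t = (l1 t * l2' - l2 t * l1') * g"
    by (subst moving[OF _ col(5) der5 col(6) der6])
      (simp_all only: fold inner_simps, (simp_all add: algebra_simps)?)
qed

text \<open>Only \<open>A\<close> and \<open>R\<close> are known to be differentiable; the entries inherit this from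
  \<open>B = R\<^sup>T A\<close>, the last three after division by \<open>l1\<close>.\<close>
lemma B_form_entries_differentiable:
  fixes R :: "real \<Rightarrow> real^3^3" and A :: "real \<Rightarrow> real^6^3"
    and b11 b12 b22 b15 b25 b35 l1 l2 :: "real \<Rightarrow> real"
  assumes R: "(R has_vector_derivative R') (at t)" and A': "(A has_vector_derivative A') (at t)"
    and I: "open I" "t \<in> I" and orth: "\<forall>s\<in>I. orthogonal_matrix (R s)"
    and A: "\<forall>s\<in>I. A s = R s **
           B_form (b11 s) (b12 s) (b22 s) (b15 s) (b25 s) (b35 s) (l1 s) (l2 s)"
    and l1: "(l1 has_real_derivative l1') (at t)" "\<forall>s\<in>I. l1 s \<noteq> 0"
  shows "(b11 has_real_derivative deriv b11 t) (at t)" "(b12 has_real_derivative deriv b12 t) (at t)"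
    "(b22 has_real_derivative deriv b22 t) (at t)" "(b15 has_real_derivative deriv b15 t) (at t)"
    "(b25 has_real_derivative deriv b25 t) (at t)" "(b35 has_real_derivative deriv b35 t) (at t)"
proof -
  note orth = orth[rule_format] and A = A[rule_format] and l1 = l1(1) l1(2)[rule_format]
  define F where "F = (\<lambda>s. transpose (R s) ** A s)"
  have F: "F s = B_form (b11 s) (b12 s) (b22 s) (b15 s) (b25 s) (b35 s) (l1 s) (l2 s)" if "s \<in> I" for s
    using orth[OF that] by (simp add: F_def A[OF that] matrix_mul_assoc orthogonal_matrix)
  obtain F' where F': "(F has_vector_derivative F') (at t)"
    unfolding F_def
    using bounded_bilinear.has_vector_derivative[OF bounded_bilinear_matrix_matrix_mult
        bounded_linear.has_vector_derivative[OF bounded_linear_transpose R] A'] by blast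
  have entry: "((\<lambda>s. F s $ i $ j) has_real_derivative F' $ i $ j) (at t)" for i j
    unfolding has_real_derivative_iff_has_vector_derivative
    by (rule bounded_linear.has_vector_derivative[OF bounded_linear_vec_nth
          bounded_linear.has_vector_derivative[OF bounded_linear_vec_nth F']])
  have der: "(b has_real_derivative deriv b t) (at t)"
    if "\<And>s. s \<in> I \<Longrightarrow> b s = F s $ i $ j" for b i j
    using has_field_derivative_transform_within_open[OF entry I, of i j b] that
    by (simp add: DERIV_imp_deriv)
  have der': "(b has_real_derivative deriv b t) (at t)"
    if b: "\<And>s. s \<in> I \<Longrightarrow> l1 s * b s = F s $ i $ j" for b i j
  proof -
    have eq: "F s $ i $ j / l1 s = b s" if "s \<in> I" for s
      using b[OF that] l1(2)[OF that] by (simp add: field_simps)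
    have "(b has_real_derivative (F'$i$j * l1 t - F t $ i $ j * l1') / (l1 t * l1 t)) (at t)"
      by (rule has_field_derivative_transform_within_open[OF DERIV_divide[OF entry l1(1)] I])
        (use l1(2) I(2) eq in auto)
    then show ?thesis by (simp add: DERIV_imp_deriv)
  qed
  have B: "F s $ 1 $ 1 = b11 s" "F s $ 1 $ 2 = b12 s" "F s $ 2 $ 2 = b22 s"
    "F s $ 1 $ 5 = l1 s * b15 s" "F s $ 2 $ 5 = l1 s * b25 s" "F s $ 3 $ 5 = l1 s * b35 s"
    if "s \<in> I" for s
    by (simp_all add: F[OF that] B_form_def) (simp_all add: vector_def)
  show "(b11 has_real_derivative deriv b11 t) (at t)" "(b12 has_real_derivative deriv b12 t) (at t)"
    "(b22 has_real_derivative deriv b22 t) (at t)"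
    by (rule der[OF B(1)[symmetric]] der[OF B(2)[symmetric]] der[OF B(3)[symmetric]]; assumption)+
  show "(b15 has_real_derivative deriv b15 t) (at t)"
    "(b25 has_real_derivative deriv b25 t) (at t)" "(b35 has_real_derivative deriv b35 t) (at t)"
    by (rule der'[OF B(4)[symmetric]] der'[OF B(5)[symmetric]] der'[OF B(6)[symmetric]]; assumption)+
qed

section \<open>Solving the first integrals\<close>

text \<open>Differentiating the relation and dividing by \<open>\<theta>' \<noteq> 0\<close> removes the constant term and turns
  \<open>(q, r)\<close> by a quarter; after two rounds only \<open>q = r = 0\<close> is possible. Dividing each time means
  that \<open>\<theta>\<close> is differentiated only once. This is the device by which an identity along the curve
  becomes relations between constants.\<close>
lemma trig_combination_eq_0:
  fixes \<theta> :: "real \<Rightarrow> real"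
  assumes "open I" "t \<in> I"
    and \<theta>: "\<forall>t\<in>I. (\<theta> has_real_derivative d t) (at t)" "\<forall>t\<in>I. d t \<noteq> 0"
    and eq: "\<forall>t\<in>I. p + q * cos (\<theta> t) + r * sin (\<theta> t) = 0"
  shows "p = 0" "q = 0" "r = 0"
proof -
  note \<theta> = \<theta>[rule_format] and eq = eq[rule_format]
  have step: "q * sin (\<theta> t) = r * cos (\<theta> t)"
    if "t \<in> I" and eq: "\<And>t. t \<in> I \<Longrightarrow> p + q * cos (\<theta> t) + r * sin (\<theta> t) = 0" for p q r t
  proof -
    have "((\<lambda>t. p + q * cos (\<theta> t) + r * sin (\<theta> t)) has_real_derivative
        d t * (r * cos (\<theta> t) - q * sin (\<theta> t))) (at t)"
      using \<theta>(1)[OF \<open>t \<in> I\<close>] by (auto intro!: derivative_eq_intros simp: algebra_simps)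
    moreover have "((\<lambda>t. p + q * cos (\<theta> t) + r * sin (\<theta> t)) has_real_derivative 0) (at t)"
      by (rule has_field_derivative_transform_within_open[OF DERIV_const \<open>open I\<close> \<open>t \<in> I\<close>])
        (simp add: eq)
    ultimately have "d t * (r * cos (\<theta> t) - q * sin (\<theta> t)) = 0"
      by (rule DERIV_unique)
    then show ?thesis
      using \<theta>(2)[OF \<open>t \<in> I\<close>] by simp
  qed
  have 1: "q * sin (\<theta> t) = r * cos (\<theta> t)" if "t \<in> I" for t
    using step[OF that eq] .
  have 2: "q * cos (\<theta> t) = - r * sin (\<theta> t)"
    using step[OF \<open>t \<in> I\<close>, of 0 r "-q"] 1 by simp
  have "q * (sin (\<theta> t)^2 + cos (\<theta> t)^2) = 0" "r * (sin (\<theta> t)^2 + cos (\<theta> t)^2) = 0"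
    using 1[OF \<open>t \<in> I\<close>] 2 by algebra+
  then show "q = 0" "r = 0"
    by simp_all
  with eq[OF \<open>t \<in> I\<close>] show "p = 0"
    by simp
qed

lemma solve_rotation:
  fixes C S p q u v :: real
  assumes "S^2 + C^2 = 1" "S * p - C * q = u" "C * p + S * q = v"
  shows "p = S * u + C * v" "q = S * v - C * u"
  using assms by algebra+

text \<open>The equations for \<open>Q\<^sub>1\<^sub>3\<close> and \<open>Q\<^sub>1\<^sub>4\<close> are a rotated linear system for two Gram entries of the
  plane spanned by the first two columns.\<close>
lemma plane_gram:
  fixes C S h c c13 c14 g11 g12 :: real
  assumes "S^2 + C^2 = 1"
    and "c13 = S * c - (- h * S) * g11 - (h * C) * g12"
    and "c14 = (1 + C) * c + (h * C) * g11 - (- h * S) * g12"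
  shows "h * g11 = c13 * S + (c14 - c) * C - c"
    and "h * g12 = (c14 - c) * S - c13 * C"
proof -
  have "S * (h * g11) - C * (h * g12) = c13 - S * c"
    "C * (h * g11) + S * (h * g12) = c14 - (1 + C) * c"
    using assms(2,3) by (simp_all add: algebra_simps)
  from solve_rotation[OF assms(1) this] assms(1)
  show "h * g11 = c13 * S + (c14 - c) * C - c" "h * g12 = (c14 - c) * S - c13 * C"
    by algebra+
qed

text \<open>Four linear equations for the pairings \<open>q1\<close>, \<open>q2\<close> and products \<open>g1\<close>, \<open>g2\<close> of the first two
  columns with \<open>U\<close>. The differences and sums below separate the unknowns, because with
  \<open>l1 = 1 + cos \<theta>\<close>, \<open>l2 = sin \<theta>\<close> one has \<open>l1\<^sup>2 - l2\<^sup>2 = 2 l1 cos \<theta>\<close> and \<open>l1\<^sup>2 + l2\<^sup>2 = 2 l1\<close>.\<close>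
lemma mixed_products:
  fixes C S h c35 c36 c45 c46 g1 g2 q1 q2 :: real
  defines "L \<equiv> 1 + C"
  assumes CS: "S^2 + C^2 = 1"
    and e: "c35 = L * (L * q1 + S * q2) + (L * (h * C) - S * (- h * S)) * g2"
      "c36 = - S * (L * q1 + S * q2) + (L * (h * C) - S * (- h * S)) * g1"
      "c45 = L * (L * q2 - S * q1) - (L * (h * C) - S * (- h * S)) * g1"
      "c46 = - S * (L * q2 - S * q1) + (L * (h * C) - S * (- h * S)) * g2"
  shows "2 * L * q1 = C * (c35 - c46) - S * (c36 + c45)"
    and "2 * L * q2 = S * (c35 - c46) + C * (c36 + c45)"
    and "2 * L * h * g1 = 2 * L * q2 + c36 - c45"
    and "2 * L * h * g2 = c35 + c46 - 2 * L * q1"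
proof -
  have S2: "S^2 = 1 - C^2" using CS by simp
  have W: "L * (h * C) - S * (- h * S) = L * h"
    using CS unfolding L_def by algebra
  have N: "L^2 - S^2 = 2 * L * C" "L^2 + S^2 = 2 * L"
    using S2 by (simp_all add: L_def power2_eq_square algebra_simps)
  have "S * (2 * L * q2) - C * (- (2 * L * q1)) = c35 - c46"
    "C * (2 * L * q2) + S * (- (2 * L * q1)) = c36 + c45"
    using N(1) unfolding e W by algebra+
  from solve_rotation[OF CS this]
  show "2 * L * q1 = C * (c35 - c46) - S * (c36 + c45)"
    "2 * L * q2 = S * (c35 - c46) + C * (c36 + c45)" by algebra+
  show "2 * L * h * g1 = 2 * L * q2 + c36 - c45" "2 * L * h * g2 = c35 + c46 - 2 * L * q1"
    using N(2) unfolding e W by algebra+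
qed

text \<open>Constancy of \<open>Q\<^sub>1\<^sub>5 - Q\<^sub>2\<^sub>6 = e1\<close> becomes a trigonometric identity with constant coefficients;
  its coefficients vanish, which later yields \<open>Q\<^sub>3\<^sub>5 = Q\<^sub>4\<^sub>5 = 0\<close>.\<close>
lemma mixed_products_constant:
  fixes C S h c35 c36 c45 c46 g1 g2 q1 q2 e1 :: real
  defines "L \<equiv> 1 + C"
  assumes CS: "S^2 + C^2 = 1"
    and e: "c35 = L * (L * q1 + S * q2) + (L * (h * C) - S * (- h * S)) * g2"
      "c36 = - S * (L * q1 + S * q2) + (L * (h * C) - S * (- h * S)) * g1"
      "c45 = L * (L * q2 - S * q1) - (L * (h * C) - S * (- h * S)) * g1"
      "c46 = - S * (L * q2 - S * q1) + (L * (h * C) - S * (- h * S)) * g2"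
    and e1: "e1 = (L * q1 - (- h * S) * g1) - (- S * q2 + (h * C) * g2)"
  shows "2 * (c35 - c46 - e1) + (- 2 * c46 - 2 * e1) * C + (- 2 * c45) * S = 0"
proof -
  note m = mixed_products[OF CS e[unfolded L_def], folded L_def]
  have "2 * L * e1 = L * (2 * L * q1) + S * (2 * L * h * g1) + S * (2 * L * q2) - C * (2 * L * h * g2)"
    by (simp add: e1 algebra_simps)
  then show ?thesis
    unfolding m using CS by (simp add: L_def) algebra
qed

text \<open>These identify the constants \<open>m2\<close>, \<open>m3\<close>, \<open>m4\<close> of the solution with \<open>2 (a - c)\<close>,
  \<open>- 2 (a + c)\<close>, \<open>- 2 s\<close>. Adding the first two gives the quadratic relation between \<open>m0\<close> and
  \<open>m1\<close>.\<close>
lemma m_identities: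
  fixes a s c \<gamma> c36 c46 m0 m1 :: real
  assumes \<gamma>: "\<gamma>^2 = c^2 - a^2 - s^2"
    and m0: "2 * m0 = c46 * (a - c) + c36 * s" and m1: "2 * m1 = c46 * s - c36 * (a + c)"
  defines "d \<equiv> c36 * m1 + c46 * m0"
  shows "\<gamma>^2 * c36^2 + 4 * m0^2 = 2 * (a - c) * d"
    and "\<gamma>^2 * c46^2 + 4 * m1^2 = - 2 * (a + c) * d"
    and "\<gamma>^2 * c36 * c46 - 4 * m0 * m1 = - 2 * s * d"
proof -
  have d: "2 * d = c46^2 * (a - c) + 2 * c36 * c46 * s - c36^2 * (a + c)"
    unfolding d_def using m0 m1 by algebra
  show "\<gamma>^2 * c36^2 + 4 * m0^2 = 2 * (a - c) * d" using \<gamma> m0 d by algebra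
  show "\<gamma>^2 * c46^2 + 4 * m1^2 = - 2 * (a + c) * d" using \<gamma> m1 d by algebra
  show "\<gamma>^2 * c36 * c46 - 4 * m0 * m1 = - 2 * s * d" using \<gamma> m0 m1 d by algebra
qed

text \<open>At a fixed time the Gram products determine the entries. With the half-angle tangent
  \<open>T = sin \<theta> / (1 + cos \<theta>)\<close> the products with \<open>U\<close> become affine in \<open>T\<close>, and
  \<open>cos \<theta> + T sin \<theta> = 1\<close>, \<open>sin \<theta> - T cos \<theta> = T\<close> make \<open>b25\<close> affine in \<open>T\<close> as well. The cubic
  law for \<open>h = \<theta>'\<close> is \<open>Q\<^sub>5\<^sub>6 = h L |U|\<^sup>2\<close>: the contribution of \<open>b15\<close> and \<open>b25\<close> is a constant,
  and the contribution of \<open>b35\<close>, known from the determinant condition, is a multiple of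
  \<open>h\<^sup>3 / L\<close>.\<close>
lemma B_form_solution:
  fixes C S T h L P D a s c c36 c46 c56 \<gamma> m0 m1 d b11 b12 b22 b15 b25 b35 :: real
  assumes CS: "S^2 + C^2 = 1" and L: "L = 1 + C" "L \<noteq> 0" and T: "T = S / L"
    and \<gamma>: "h * b11 * b22 = \<gamma>" "\<gamma> \<noteq> 0" "\<gamma>^2 = c^2 - a^2 - s^2"
    and P: "P = a * C + s * S - c" and D: "D = s * C - a * S"
    and m0: "2 * m0 = c46 * (a - c) + c36 * s" and m1: "2 * m1 = c46 * s - c36 * (a + c)"
    and d: "d = c36 * m1 + c46 * m0"
    and g11: "h * b11^2 = P" and g12: "h * (b11 * b12) = - D"
    and g1: "2 * L * h * (b11 * b15) = L * c36 - c46 * S"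
    and g2: "2 * L * h * (b12 * b15 + b22 * b25) = L * c46 + c36 * S"
    and g: "h * L * (b15^2 + b25^2 + b35^2) = c56"
    and det: "b11 * b22 * b35 * (L^2 + S^2) + 1 = 0"
  shows "P \<noteq> 0" "b12 = - D / P * b11" "b15 = (c36 - c46 * T) / (2 * P) * b11"
    "b25 = (m1 * T + m0) / \<gamma>^2 * b22"
    "2 * (m1 * T + m0) = (c46 + c36 * T) * P + D * (c36 - c46 * T)"
    "b35 = - h / (2 * \<gamma> * L)"
    "h^3 = 4 * (c56 * \<gamma>^2 - d) * L"
proof -
  have nz: "h \<noteq> 0" "b11 \<noteq> 0" "b22 \<noteq> 0"
    using \<gamma>(1,2) by auto
  have ST: "S = L * T" using L T by simp
  \<comment> \<open>Half-angle identities in terms of \<open>T\<close>.\<close>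
  have LT: "L * (1 + T^2) = 2"
  proof -
    have "L * (L * (1 + T^2)) = L * 2"
      using CS unfolding ST L(1) by algebra
    then show ?thesis using L(2) by simp
  qed
  have CT: "C + S * T = 1" "S - C * T = T"
    using LT unfolding ST by (simp_all add: L(1) power2_eq_square algebra_simps)
  show P0: "P \<noteq> 0" using g11 nz by auto
  have "P * b12 = - D * b11"
    unfolding g11[symmetric] using g12 by algebra
  then show "b12 = - D / P * b11" using P0 by (simp add: field_simps)
  have g1': "2 * h * (b11 * b15) = c36 - c46 * T"
  proof -
    have "L * (2 * h * (b11 * b15)) = L * (c36 - c46 * T)"
      using g1 ST by (simp add: algebra_simps)
    then show ?thesis using L(2) by simp
  qed
  have g2': "2 * h * (b12 * b15 + b22 * b25) = c46 + c36 * T"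
  proof -
    have "L * (2 * h * (b12 * b15 + b22 * b25)) = L * (c46 + c36 * T)"
      using g2 ST by (simp add: algebra_simps)
    then show ?thesis using L(2) by simp
  qed
  have "2 * P * b15 = (c36 - c46 * T) * b11"
    using g1' g11 by algebra
  then show "b15 = (c36 - c46 * T) / (2 * P) * b11" using P0 by (simp add: field_simps)
  show M: "2 * (m1 * T + m0) = (c46 + c36 * T) * P + D * (c36 - c46 * T)"
  proof -
    have "(c46 + c36 * T) * P + D * (c36 - c46 * T) =
        (c46 * a + c36 * s) * (C + S * T) + (c46 * s - c36 * a) * (S - C * T) - c * (c46 + c36 * T)"
      unfolding P D by (simp add: algebra_simps)
    also have "\<dots> = 2 * (m1 * T + m0)"
      unfolding CT using m0 m1 by algebra
    finally show ?thesis by simp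
  qed
  have "2 * h * \<gamma> * b11 * b25 = (c46 + c36 * T) * P + D * (c36 - c46 * T)"
    unfolding g11[symmetric] g1'[symmetric] g2'[symmetric] \<gamma>(1)[symmetric]
    using g12 by algebra
  then have b25: "h * \<gamma> * b11 * b25 = m1 * T + m0" using M by simp
  have "\<gamma>^2 * b25 = (m1 * T + m0) * b22"
    unfolding b25[symmetric] \<gamma>(1)[symmetric] by algebra
  then show b25': "b25 = (m1 * T + m0) / \<gamma>^2 * b22"
    using \<gamma>(2) by (simp add: field_simps)
  have "L^2 + S^2 = 2 * L"
    using CS L(1) by algebra
  with det have "b11 * b22 * b35 * (2 * L) = - 1" by simp
  then have b35: "2 * \<gamma> * L * b35 = - h"
    unfolding \<gamma>(1)[symmetric] by algebra
  then show "b35 = - h / (2 * \<gamma> * L)"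
    using \<gamma>(2) L(2) by (simp add: field_simps)
  note id = m_identities[OF \<gamma>(3) m0 m1, folded d]
  have "L * (\<gamma>^2 * (c36 - c46 * T)^2 + 4 * (m1 * T + m0)^2) = 4 * d * P"
  proof -
    have "L * T^2 = 1 - C" using CT(1) ST by algebra
    then have "L * (\<gamma>^2 * (c36 - c46 * T)^2 + 4 * (m1 * T + m0)^2) =
        (1 + C) * (\<gamma>^2 * c36^2 + 4 * m0^2) + (1 - C) * (\<gamma>^2 * c46^2 + 4 * m1^2)
          - 2 * S * (\<gamma>^2 * c36 * c46 - 4 * m0 * m1)"
      using ST L(1) by algebra
    also have "\<dots> = 4 * d * P"
      unfolding id P by (simp add: algebra_simps)
    finally show ?thesis .
  qed
  moreover have "\<gamma>^2 * (c36 - c46 * T)^2 + 4 * (m1 * T + m0)^2 = 4 * h * \<gamma>^2 * P * (b15^2 + b25^2)"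
    unfolding b25[symmetric] g1'[symmetric] g11[symmetric] by algebra
  ultimately have "P * (h * L * \<gamma>^2 * (b15^2 + b25^2)) = P * d"
    by algebra
  then have d': "h * L * \<gamma>^2 * (b15^2 + b25^2) = d" using P0 by simp
  have "4 * L * (c56 * \<gamma>^2 - d) = h * (2 * \<gamma> * L * b35)^2"
    unfolding g[symmetric] d'[symmetric] by algebra
  then show "h^3 = 4 * (c56 * \<gamma>^2 - d) * L"
    unfolding b35 by algebra
qed

text \<open>Each of the three pairings contains one new component of the rotation vector: \<open>q12\<close> gives
  \<open>w3\<close>, then \<open>q1\<close> gives \<open>w2\<close>, then \<open>q2\<close> gives \<open>w1\<close>. Writing \<open>b12 = x b11\<close>, \<open>b15 = y b11\<close>,
  \<open>b25 = z b22\<close> removes the derivatives of \<open>b11\<close> and \<open>b22\<close> from the pairings, since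
  \<open>f' g - g' f\<close> depends on the derivatives only through \<open>(f/g)'\<close>; the rest is algebra in \<open>cos \<theta>\<close>, \<open>sin \<theta>\<close>, \<open>T\<close>.\<close>
lemma rotation_of_B_form_solution:
  fixes C S T h L P D a s c c36 c46 \<gamma> m0 m1 x y b11 b12 b22 b15 b25 b35 w1 w2 w3 :: real
  assumes CS: "S^2 + C^2 = 1" and L: "L = 1 + C" "L \<noteq> 0" and T: "T = S / L"
    and \<gamma>: "h * b11 * b22 = \<gamma>" "\<gamma> \<noteq> 0" "\<gamma>^2 = c^2 - a^2 - s^2"
    and P: "P = a * C + s * S - c" "P \<noteq> 0" and D: "D = s * C - a * S"
    and m1: "2 * m1 = c46 * s - c36 * (a + c)"
    and M: "2 * (m1 * T + m0) = (c46 + c36 * T) * P + D * (c36 - c46 * T)"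
    and g11: "h * b11^2 = P" and b35: "b35 \<noteq> 0"
    and x: "x = - D / P" "b12 = x * b11" "b12' = x' * b11 + x * b11'"
    and x': "x' = - h * (\<gamma>^2 + c * P) / P^2"
    and y: "y = (c36 - c46 * T) / (2 * P)" "b15 = y * b11" "b15' = y' * b11 + y * b11'"
    and y': "y' = h * (- (c46 / L) / (2 * P) - (c36 - c46 * T) * D / (2 * P^2))"
    and z: "z = (m1 * T + m0) / \<gamma>^2" "b25 = z * b22" "b25' = z' * b22 + z * b22'"
    and z': "z' = h * m1 / (L * \<gamma>^2)"
    and q12: "c = w3 * b11 * b22 + b11' * b12 - b12' * b11"
    and q1: "q1 = - w2 * b11 * b35 + w3 * b11 * b25 + b11' * b15 - b15' * b11"
      "2 * L * q1 = - (c46 * C + c36 * S)"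
    and q2: "q2 = w1 * b22 * b35 - w2 * b12 * b35 + w3 * (b12 * b25 - b22 * b15)
          + b12' * b15 - b15' * b12 + b22' * b25 - b25' * b22"
      "2 * L * q2 = c36 * C - c46 * S"
  shows "w3 = - \<gamma> / b11^2" "w2 = 0" "w1 = 0"
proof -
  have nz: "h \<noteq> 0" "b11 \<noteq> 0" "b22 \<noteq> 0"
    using \<gamma>(1,2) by auto
  have ST: "S = L * T" using L T by simp
  have g22: "h * b22^2 * P = \<gamma>^2"
    unfolding \<gamma>(1)[symmetric] g11[symmetric] by algebra
  define v where "v = w3 * b11 * b22"
  have bx: "b11^2 * x' = - (\<gamma>^2 + c * P) / P"
  proof -
    have "b11^2 * x' = - (h * b11^2) * (\<gamma>^2 + c * P) / P^2"
      unfolding x' by (simp add: algebra_simps)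
    then show ?thesis
      unfolding g11 using P(2) by (simp add: power2_eq_square minus_divide_left)
  qed
  have v: "v = - (\<gamma>^2) / P"
  proof -
    have "v = c + b11^2 * x'"
      using q12 unfolding v_def x(2,3) by algebra
    then show ?thesis unfolding bx using P(2) by (simp add: field_simps)
  qed
  have "P * v = w3 * h * b11^2 * (b11 * b22)"
    unfolding v_def g11[symmetric] by algebra
  then have "w3 * b11^2 * \<gamma> = - (\<gamma>^2)"
    unfolding v \<gamma>(1)[symmetric] using P(2) by simp
  then have "\<gamma> * (w3 * b11^2) = \<gamma> * (- \<gamma>)"
    by algebra
  then have "w3 * b11^2 = - \<gamma>"
    using \<gamma>(2) by (simp only: mult_cancel_left) simp
  then show "w3 = - \<gamma> / b11^2"
    using nz(2) by (simp add: field_simps)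
  have by': "2 * P * (b11^2 * y') = - P * (c46 / L) - (c36 - c46 * T) * D"
  proof -
    have "2 * P * (b11^2 * y') =
        (h * b11^2) * (2 * P) * (- (c46 / L) / (2 * P) - (c36 - c46 * T) * D / (2 * P^2))"
      unfolding y' by (simp only: ac_simps)
    then show ?thesis
      unfolding g11 using P(2) by (simp add: power2_eq_square right_diff_distrib)
  qed
  have vz: "P * (v * z) = - (m1 * T + m0)"
    unfolding v z(1) using P(2) \<gamma>(2) by simp
  have "q1 = - w2 * b11 * b35 + v * z - b11^2 * y'"
    unfolding q1(1) v_def z(2) y(2,3) by algebra
  then have "2 * P * (w2 * b11 * b35) = - 2 * P * q1 + 2 * (P * (v * z)) - 2 * P * (b11^2 * y')"
    by algebra
  also have "\<dots> = - 2 * P * q1 - P * (c46 + c36 * T) + P * (c46 / L)"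
    unfolding vz by' using M by algebra
  also have "\<dots> = 0"
  proof -
    have "L * (- 2 * P * q1 - P * (c46 + c36 * T) + P * (c46 / L)) =
        - P * (2 * L * q1) - P * (L * c46 + c36 * S) + P * c46"
      using L(2) ST by (simp add: algebra_simps)
    also have "\<dots> = 0" using q1(2) L(1) by algebra
    finally show ?thesis using L(2) by simp
  qed
  finally show w2: "w2 = 0" using P(2) nz b35 by simp
  have bz: "L * P * (b22^2 * z') = m1"
    unfolding z' using g22 L(2) \<gamma>(2) by (simp add: field_simps)
  have q2': "q2 = w1 * b22 * b35 + v * (x * z - y) + (b11^2 * x') * y - x * (b11^2 * y') - b22^2 * z'"
    unfolding q2(1) v_def x(2,3) y(2,3) z(2,3) w2 by algebra
  have Px: "P * x = - D" and Py: "2 * P * y = c36 - c46 * T"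
    unfolding x(1) y(1) using P(2) by simp_all
  have Pv: "P * v = - (\<gamma>^2)" and Pb: "P * (b11^2 * x') = - (\<gamma>^2 + c * P)"
    unfolding v bx using P(2) by simp_all
  have LL: "L * (c46 / L) = c46" using L(2) by simp
  have "2 * L * P * (w1 * b22 * b35) = 2 * L * P * q2 + L * (c46 + c36 * T) * (- D)
      + L * c * (c36 - c46 * T) + D * c46 + 2 * m1"
  proof -
    have "2 * L * P^2 * (w1 * b22 * b35) = 2 * L * P^2 * q2 - 2 * L * P * x * (P * (v * z))
       + L * (P * v) * (2 * P * y) - L * (P * (b11^2 * x')) * (2 * P * y)
       + L * (P * x) * (2 * P * (b11^2 * y')) + 2 * P * (L * P * (b22^2 * z'))"
      unfolding q2' by algebra
    also have "\<dots> = P * (2 * L * P * q2 + L * (c46 + c36 * T) * (- D)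
      + L * c * (c36 - c46 * T) + D * c46 + 2 * m1)"
      unfolding vz Pv Pb Py by' bz using Px M LL by algebra
    finally have "P * (2 * L * P * (w1 * b22 * b35)) = P * (2 * L * P * q2
      + L * (c46 + c36 * T) * (- D) + L * c * (c36 - c46 * T) + D * c46 + 2 * m1)"
      by algebra
    then show ?thesis
      using P(2) by (simp only: mult_cancel_left) simp
  qed
  also have "\<dots> = 0"
  proof -
    have "2 * L * P * q2 = P * (c36 * C - c46 * S)" using q2(2) by algebra
    moreover have "L * (c46 + c36 * T) = L * c46 + c36 * S" "L * c * (c36 - c46 * T) = c * (L * c36 - c46 * S)"
      using ST by (simp_all add: algebra_simps)
    ultimately have "2 * L * P * q2 + L * (c46 + c36 * T) * (- D) + L * c * (c36 - c46 * T)
        + D * c46 + 2 * m1 = P * (c36 * C - c46 * S) + (L * c46 + c36 * S) * (- D)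
        + c * (L * c36 - c46 * S) + D * c46 + (c46 * s - c36 * (a + c))"
      using m1 by (simp only:)
    also have "\<dots> = 0"
      unfolding P(1) D L(1) using CS by algebra
    finally show ?thesis .
  qed
  finally show "w1 = 0" using L(2) P(2) nz b35 by simp
qed

section \<open>The solution and its rotation vector\<close>

theorem theorem7p7:
  fixes I :: "real set"
    and A :: "real \<Rightarrow> real^6^3" and R :: "real \<Rightarrow> real^3^3"
    and b11 b12 b22 b15 b25 b35 l1 l2 \<theta> :: "real \<Rightarrow> real"
    and \<gamma> :: real and c :: "6 \<Rightarrow> 6 \<Rightarrow> real"
  assumes "open I" and "is_interval I" and "I \<noteq> {}"
    and "smooth_curve_on I A" and "smooth_curve_on I R"
    and "\<And>t. t \<in> I \<Longrightarrow> rotation_matrix (R t)"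
    and "\<And>t. t \<in> I \<Longrightarrow> A t = R t **
           B_form (b11 t) (b12 t) (b22 t) (b15 t) (b25 t) (b35 t) (l1 t) (l2 t)"
    and "\<And>t. t \<in> I \<Longrightarrow> b11 t * b22 t * b35 t * ((l1 t)^2 + (l2 t)^2) + 1 = 0"
    and "\<And>t. t \<in> I \<Longrightarrow> l1 t = 1 + cos (\<theta> t)"
    and "\<And>t. t \<in> I \<Longrightarrow> l2 t = sin (\<theta> t)"
    and "\<And>t. t \<in> I \<Longrightarrow> \<theta> differentiable (at t)"
    and "\<And>t. t \<in> I \<Longrightarrow> deriv \<theta> t * b11 t * b22 t = \<gamma>"
    and "\<gamma> \<noteq> 0"
    and "\<And>t i j. t \<in> I \<Longrightarrow>
           (i, j) \<in> {(1,2), (1,3), (1,4), (2,3), (2,4), (3,5), (3,6), (4,5), (4,6), (5,6)} \<Longrightarrow>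
           Q A i j t = c i j"
    and "(\<lambda>t. Q A 1 5 t - Q A 2 6 t) constant_on I"
    and "(\<lambda>t. Q A 1 6 t + Q A 2 5 t) constant_on I"
    and "c 1 2 \<noteq> 0"
    and "(c 3 6, c 4 6) \<noteq> (0, 0)"
  shows "\<exists>m0 m1 :: real.
    ((c 3 6)^2 + (c 4 6)^2) * \<gamma>^2 + 4 * c 1 2 * (c 4 6 * m0 + c 3 6 * m1)
      + 4 * m0^2 + 4 * m1^2 = 0 \<and>
    c 3 6 * m1 + c 4 6 * m0 \<noteq> 0 \<and>
    (let m2 = (\<gamma>^2 * (c 3 6)^2 + 4 * m0^2) / (c 3 6 * m1 + c 4 6 * m0);
         m3 = (\<gamma>^2 * (c 4 6)^2 + 4 * m1^2) / (c 3 6 * m1 + c 4 6 * m0);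
         m4 = (\<gamma>^2 * c 3 6 * c 4 6 - 4 * m0 * m1) / (c 3 6 * m1 + c 4 6 * m0);
         \<beta> = (\<lambda>t. (c 3 6 * sin (\<theta> t) - c 4 6 * (1 - cos (\<theta> t))) / (2 * \<gamma> * sin (\<theta> t)) * b22 t)
     in \<forall>t\<in>I.
          (if sin (\<theta> t) = 0 then cos (\<theta> t) = 1 \<and> (\<beta> \<longlongrightarrow> b15 t) (at t) else b15 t = \<beta> t) \<and>
          b25 t = (m1 * sin (\<theta> t) + m0 * (1 + cos (\<theta> t))) / (\<gamma>^2 * (1 + cos (\<theta> t))) * b22 t \<and>
          (deriv \<theta> t)^3 = 4 * (c 5 6 * \<gamma>^2 - c 3 6 * m1 - c 4 6 * m0) * (1 + cos (\<theta> t)) \<and>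
          b35 t = - deriv \<theta> t / (2 * \<gamma> * (1 + cos (\<theta> t))) \<and>
          (b11 t)^2 = ((m2 - m3) * cos (\<theta> t) - 2 * m4 * sin (\<theta> t) + m2 + m3) / (4 * deriv \<theta> t) \<and>
          b12 t = ((m2 - m3) * sin (\<theta> t) + 2 * m4 * cos (\<theta> t)) / (4 * b11 t * deriv \<theta> t) \<and>
          b22 t = \<gamma> / (b11 t * deriv \<theta> t) \<and>
          rot_vec R t $ 1 = 0 \<and> rot_vec R t $ 2 = 0 \<and>
          rot_vec R t $ 3 = - \<gamma> / (b11 t)^2)"
proof -
  have I: "open I" by fact
  note \<gamma>0 = \<open>\<gamma> \<noteq> 0\<close>
  obtain t0 where t0: "t0 \<in> I" using \<open>I \<noteq> {}\<close> by blast
  define h where "h = deriv \<theta>"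
  define C S L T where "C = (\<lambda>t. cos (\<theta> t))" and "S = (\<lambda>t. sin (\<theta> t))"
    and "L = (\<lambda>t. 1 + C t)" and "T = (\<lambda>t. S t / L t)"
  have CS: "S t ^ 2 + C t ^ 2 = 1" for t by (simp add: C_def S_def)
  have \<theta>: "(\<theta> has_real_derivative h t) (at t)" if "t \<in> I" for t
    using assms(11)[OF that] by (simp add: h_def DERIV_deriv_iff_real_differentiable)
  have \<gamma>: "h t * b11 t * b22 t = \<gamma>" if "t \<in> I" for t
    using assms(12)[OF that] by (simp add: h_def)
  have nz: "h t \<noteq> 0" "b11 t \<noteq> 0" "b22 t \<noteq> 0" if "t \<in> I" for t
    using \<gamma>[OF that] \<gamma>0 by auto
  have l: "l1 t = L t" "l2 t = S t" if "t \<in> I" for t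
    using assms(9,10)[OF that] by (simp_all add: L_def C_def S_def)
  have det: "b11 t * b22 t * b35 t * (L t ^ 2 + S t ^ 2) + 1 = 0" if "t \<in> I" for t
    using assms(8)[OF that] l[OF that] by simp
  have L: "L t \<noteq> 0" and b35: "b35 t \<noteq> 0" if "t \<in> I" for t
  proof -
    have "L t ^ 2 + S t ^ 2 = 2 * L t"
      using CS[of t] unfolding L_def by algebra
    with det[OF that] show "L t \<noteq> 0" "b35 t \<noteq> 0" by auto
  qed
  have dS: "(S has_real_derivative h t * C t) (at t)"
    and dC: "(C has_real_derivative - h t * S t) (at t)"
    and dL: "(L has_real_derivative - h t * S t) (at t)" if "t \<in> I" for t
    unfolding S_def C_def L_def using \<theta>[OF that]
    by (auto intro!: derivative_eq_intros)
  have dT: "(T has_real_derivative h t / L t) (at t)" if "t \<in> I" for t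
  proof -
    have "(T has_real_derivative (h t * C t * L t - S t * (- h t * S t)) / (L t * L t)) (at t)"
      unfolding T_def by (rule DERIV_divide[OF dS[OF that] dL[OF that] L[OF that]])
    moreover have "h t * C t * L t - S t * (- h t * S t) = h t * L t"
      using CS[of t] unfolding L_def by algebra
    ultimately show ?thesis using L[OF that] by simp
  qed
  have dl: "(l1 has_real_derivative - h t * S t) (at t)"
    "(l2 has_real_derivative h t * C t) (at t)" if "t \<in> I" for t
    using has_field_derivative_transform_within_open[OF dL[OF that] I that]
      has_field_derivative_transform_within_open[OF dS[OF that] I that] l by auto
  have R: "(R has_vector_derivative vector_derivative R (at t)) (at t)"
    and A: "(A has_vector_derivative vector_derivative A (at t)) (at t)" if "t \<in> I" for t
    using assms(4,5) that unfolding smooth_curve_on_def vector_derivative_works[symmetric]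
    by (metis funpow_0)+
  have orth: "\<forall>s\<in>I. orthogonal_matrix (R s)"
    using assms(6) by (simp add: rotation_matrix_def)
  have AB: "\<forall>s\<in>I. A s = R s **
      B_form (b11 s) (b12 s) (b22 s) (b15 s) (b25 s) (b35 s) (l1 s) (l2 s)"
    using assms(7) by blast
  have l1nz: "\<forall>s\<in>I. l1 s \<noteq> 0"
    using L l by simp
  note db = B_form_entries_differentiable[OF R A I _ orth AB dl(1) l1nz]
  define q12 q1 q2
    where "q12 = (\<lambda>t. rot_vec R t $ 3 * b11 t * b22 t + deriv b11 t * b12 t - deriv b12 t * b11 t)"
      and "q1 = (\<lambda>t. - rot_vec R t $ 2 * b11 t * b35 t + rot_vec R t $ 3 * b11 t * b25 t
          + deriv b11 t * b15 t - deriv b15 t * b11 t)"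
      and "q2 = (\<lambda>t. rot_vec R t $ 1 * b22 t * b35 t - rot_vec R t $ 2 * b12 t * b35 t
          + rot_vec R t $ 3 * (b12 t * b25 t - b22 t * b15 t)
          + deriv b12 t * b15 t - deriv b15 t * b12 t + deriv b22 t * b25 t - deriv b25 t * b22 t)"
  have Qc: "Q A 1 2 t = c 1 2" "Q A 1 3 t = c 1 3" "Q A 1 4 t = c 1 4" "Q A 2 3 t = c 2 3"
    "Q A 2 4 t = c 2 4" "Q A 3 5 t = c 3 5" "Q A 3 6 t = c 3 6" "Q A 4 5 t = c 4 5"
    "Q A 4 6 t = c 4 6" "Q A 5 6 t = c 5 6" if "t \<in> I" for t
    by (rule assms(14)[OF that], simp)+
  obtain e1 where e1: "Q A 1 5 t - Q A 2 6 t = e1" if "t \<in> I" for t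
    using assms(15) unfolding constant_on_def by blast
  define g11 g12 g22 g1 g2 where "g11 = (\<lambda>t. (b11 t)^2)" and "g12 = (\<lambda>t. b11 t * b12 t)"
    and "g22 = (\<lambda>t. (b12 t)^2 + (b22 t)^2)"
    and "g1 = (\<lambda>t. b11 t * b15 t)" and "g2 = (\<lambda>t. b12 t * b15 t + b22 t * b25 t)"
  have Q: "c 1 2 = q12 t"
    "c 1 3 = S t * c 1 2 - (- h t * S t) * g11 t - (h t * C t) * g12 t"
    "c 1 4 = (1 + C t) * c 1 2 + (h t * C t) * g11 t - (- h t * S t) * g12 t"
    "c 2 3 = - L t * c 1 2 - (- h t * S t) * g12 t - (h t * C t) * g22 t"
    "c 2 4 = S t * c 1 2 + (h t * C t) * g12 t - (- h t * S t) * g22 t"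
    "e1 = ((1 + C t) * q1 t - (- h t * S t) * g1 t) - (- S t * q2 t + (h t * C t) * g2 t)"
    "c 3 5 = (1 + C t) * ((1 + C t) * q1 t + S t * q2 t)
        + ((1 + C t) * (h t * C t) - S t * (- h t * S t)) * g2 t"
    "c 3 6 = - S t * ((1 + C t) * q1 t + S t * q2 t)
        + ((1 + C t) * (h t * C t) - S t * (- h t * S t)) * g1 t"
    "c 4 5 = (1 + C t) * ((1 + C t) * q2 t - S t * q1 t)
        - ((1 + C t) * (h t * C t) - S t * (- h t * S t)) * g1 t"
    "c 4 6 = - S t * ((1 + C t) * q2 t - S t * q1 t)
        + ((1 + C t) * (h t * C t) - S t * (- h t * S t)) * g2 t"
    "c 5 6 = ((1 + C t) * (h t * C t) - S t * (- h t * S t)) * ((b15 t)^2 + (b25 t)^2 + (b35 t)^2)"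
    if t: "t \<in> I" for t
  proof -
    have l': "l1 t = 1 + C t" "l2 t = S t" using l[OF t] by (simp_all add: L_def)
    note Q = Q_B_form[OF R[OF t] I t orth AB db[OF t t t t] dl[OF t],
        unfolded Qc[OF t] l']
    show q: "c 1 2 = q12 t" using Q(1) by (simp only: q12_def)
    note Q' = Q(2-)[folded Q(1)]
    show "e1 = ((1 + C t) * q1 t - (- h t * S t) * g1 t) - (- S t * q2 t + (h t * C t) * g2 t)"
      unfolding e1[OF t, symmetric] Q'(5,6) by (simp only: q1_def q2_def g1_def g2_def)
    from Q' show "c 1 3 = S t * c 1 2 - (- h t * S t) * g11 t - (h t * C t) * g12 t"
    "c 1 4 = (1 + C t) * c 1 2 + (h t * C t) * g11 t - (- h t * S t) * g12 t"
    "c 2 3 = - L t * c 1 2 - (- h t * S t) * g12 t - (h t * C t) * g22 t"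
    "c 2 4 = S t * c 1 2 + (h t * C t) * g12 t - (- h t * S t) * g22 t"
    "c 3 5 = (1 + C t) * ((1 + C t) * q1 t + S t * q2 t)
        + ((1 + C t) * (h t * C t) - S t * (- h t * S t)) * g2 t"
    "c 3 6 = - S t * ((1 + C t) * q1 t + S t * q2 t)
        + ((1 + C t) * (h t * C t) - S t * (- h t * S t)) * g1 t"
    "c 4 5 = (1 + C t) * ((1 + C t) * q2 t - S t * q1 t)
        - ((1 + C t) * (h t * C t) - S t * (- h t * S t)) * g1 t"
    "c 4 6 = - S t * ((1 + C t) * q2 t - S t * q1 t)
        + ((1 + C t) * (h t * C t) - S t * (- h t * S t)) * g2 t"
    "c 5 6 = ((1 + C t) * (h t * C t) - S t * (- h t * S t)) * ((b15 t)^2 + (b25 t)^2 + (b35 t)^2)"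
      by (simp_all only: g11_def g12_def g22_def g1_def g2_def q1_def q2_def L_def)
  qed
  \<comment> \<open>\<open>P\<close> and \<open>- D\<close> are the trigonometric polynomials that \<open>\<theta>' g\<^sub>1\<^sub>1\<close> and \<open>\<theta>' g\<^sub>1\<^sub>2\<close> turn out
     to be; note \<open>P' = \<theta>' D\<close>.\<close>
  define a s c0 where "a = c 1 4 - c 1 2" and "s = c 1 3" and "c0 = c 1 2"
  define P D where "P = (\<lambda>t. a * C t + s * S t - c0)" and "D = (\<lambda>t. s * C t - a * S t)"
  have defs: "L t = 1 + C t" "T t = S t / L t" "P t = a * C t + s * S t - c0"
    "D t = s * C t - a * S t" for t
    by (simp_all add: L_def T_def P_def D_def)
  \<comment> \<open>These values are forced by \<open>b25\<close>: they are read off from \<open>\<theta>' \<gamma> b11 b25\<close>, which is affine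
     in \<open>T = tan (\<theta>/2)\<close>.\<close>
  define m0 where "m0 = (c 4 6 * (a - c0) + c 3 6 * s) / 2"
  define m1 where "m1 = (c 4 6 * s - c 3 6 * (a + c0)) / 2"
  have m0: "2 * m0 = c 4 6 * (a - c0) + c 3 6 * s" and m1: "2 * m1 = c 4 6 * s - c 3 6 * (a + c0)"
    by (simp_all add: m0_def m1_def)
  define d where "d = c 3 6 * m1 + c 4 6 * m0"
  have "\<forall>t\<in>I. (\<theta> has_real_derivative h t) (at t)" "\<forall>t\<in>I. h t \<noteq> 0"
    using \<theta> nz(1) by blast+
  note trig = trig_combination_eq_0[OF I t0 this]
  have G: "h t * g11 t = P t" "h t * g12 t = - D t" if t: "t \<in> I" for t
    using plane_gram[OF CS Q(2,3)[OF t]] by (simp_all add: P_def D_def a_def s_def c0_def)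
  have G': "h t * g12 t = (c 2 3 + c0) * S t + c 2 4 * C t"
    "h t * g22 t = c 2 4 * S t - (c 2 3 + c0) * C t - c0" if t: "t \<in> I" for t
  proof -
    have "S t * (h t * g12 t) - C t * (h t * g22 t) = c 2 3 + L t * c0"
      "C t * (h t * g12 t) + S t * (h t * g22 t) = c 2 4 - S t * c0"
      using Q(4,5)[OF t] by (simp_all add: c0_def algebra_simps)
    from solve_rotation[OF CS this] CS[of t]
    show "h t * g12 t = (c 2 3 + c0) * S t + c 2 4 * C t"
      "h t * g22 t = c 2 4 * S t - (c 2 3 + c0) * C t - c0"
      unfolding L_def by algebra+
  qed
  \<comment> \<open>The two expressions for \<open>\<theta>' g\<^sub>1\<^sub>2\<close> agree along the curve, hence so do their coefficients.\<close>
  have "0 + (c 2 4 + s) * cos (\<theta> t) + (c 2 3 + c0 - a) * sin (\<theta> t) = 0" if t: "t \<in> I" for t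
    using G(2)[OF t] G'(1)[OF t] by (simp add: C_def S_def D_def algebra_simps)
  then have "\<forall>t\<in>I. 0 + (c 2 4 + s) * cos (\<theta> t) + (c 2 3 + c0 - a) * sin (\<theta> t) = 0"
    by blast
  from trig(2,3)[OF this] have c2: "c 2 4 = - s" "c 2 3 + c0 = a"
    by simp_all
  have \<gamma>2: "\<gamma>^2 = c0^2 - a^2 - s^2"
  proof -
    have "\<gamma>^2 = (h t0 * g11 t0) * (h t0 * g22 t0) - (h t0 * g12 t0)^2"
      unfolding \<gamma>[OF t0, symmetric] g11_def g12_def g22_def by algebra
    also have "\<dots> = c0^2 - a^2 - s^2"
      unfolding G(1)[OF t0] G'[OF t0] c2 P_def using CS[of t0] by algebra
    finally show ?thesis .
  qed
  have "2 * (c 3 5 - c 4 6 - e1) + (- 2 * c 4 6 - 2 * e1) * cos (\<theta> t) + (- 2 * c 4 5) * sin (\<theta> t) = 0"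
    if t: "t \<in> I" for t
    using mixed_products_constant[OF CS Q(7-10)[OF t] Q(6)[OF t]]
    by (simp add: C_def S_def)
  then have "\<forall>t\<in>I. 2 * (c 3 5 - c 4 6 - e1) + (- 2 * c 4 6 - 2 * e1) * cos (\<theta> t)
      + (- 2 * c 4 5) * sin (\<theta> t) = 0"
    by blast
  from trig[OF this] have c35: "c 3 5 = 0" and c45: "c 4 5 = 0"
    by simp_all
  have M: "2 * L t * q1 t = - (c 4 6 * C t + c 3 6 * S t)"
    "2 * L t * q2 t = c 3 6 * C t - c 4 6 * S t"
    "2 * L t * h t * g1 t = L t * c 3 6 - c 4 6 * S t"
    "2 * L t * h t * g2 t = L t * c 4 6 + c 3 6 * S t" if t: "t \<in> I" for t
    using mixed_products[OF CS Q(7-10)[OF t], unfolded c35 c45]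
    by (simp_all add: L_def algebra_simps)
  have g: "h t * L t * ((b15 t)^2 + (b25 t)^2 + (b35 t)^2) = c 5 6" if t: "t \<in> I" for t
  proof -
    have "(1 + C t) * (h t * C t) - S t * (- h t * S t) = h t * L t"
      using CS[of t] unfolding L_def by algebra
    then show ?thesis using Q(11)[OF t] by simp
  qed
  have sol: "P t \<noteq> 0" "b12 t = - D t / P t * b11 t"
    "b15 t = (c 3 6 - c 4 6 * T t) / (2 * P t) * b11 t"
    "b25 t = (m1 * T t + m0) / \<gamma>^2 * b22 t"
    "2 * (m1 * T t + m0) = (c 4 6 + c 3 6 * T t) * P t + D t * (c 3 6 - c 4 6 * T t)"
    "b35 t = - h t / (2 * \<gamma> * L t)"
    "h t ^ 3 = 4 * (c 5 6 * \<gamma>^2 - d) * L t" if t: "t \<in> I" for t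
    using B_form_solution[OF CS defs(1) L[OF t]
        defs(2) \<gamma>[OF t] \<gamma>0 \<gamma>2
        defs(3) defs(4) m0 m1
        d_def G(1)[OF t, unfolded g11_def] G(2)[OF t, unfolded g12_def] M(3)[OF t, unfolded g1_def]
        M(4)[OF t, unfolded g2_def] g[OF t] det[OF t]] .
  have w: "rot_vec R t $ 3 = - \<gamma> / (b11 t)^2" "rot_vec R t $ 2 = 0" "rot_vec R t $ 1 = 0"
    if t: "t \<in> I" for t
  proof -
    define x y z where "x = (\<lambda>t. - D t / P t)" and "y = (\<lambda>t. (c 3 6 - c 4 6 * T t) / (2 * P t))"
      and "z = (\<lambda>t. (m1 * T t + m0) / \<gamma>^2)"
    have dP: "(P has_real_derivative h t * D t) (at t)"
      unfolding P_def D_def using dS[OF t] dC[OF t]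
      by (auto intro!: derivative_eq_intros simp: algebra_simps)
    have dD: "(D has_real_derivative - h t * (P t + c0)) (at t)"
      unfolding P_def D_def using dS[OF t] dC[OF t]
      by (auto intro!: derivative_eq_intros simp: algebra_simps)
    have dx: "(x has_real_derivative - h t * (\<gamma>^2 + c0 * P t) / (P t)^2) (at t)"
    proof -
      have "(x has_real_derivative (h t * (P t + c0) * P t + D t * (h t * D t)) / (P t)^2) (at t)"
        using DERIV_divide[OF DERIV_minus[OF dD] dP sol(1)[OF t]]
        by (simp add: x_def power2_eq_square)
      moreover have "h t * (P t + c0) * P t + D t * (h t * D t) = - h t * (\<gamma>^2 + c0 * P t)"
        unfolding \<gamma>2 P_def D_def using CS[of t] by algebra
      ultimately show ?thesis by simp
    qed
    have dy: "(y has_real_derivative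
        h t * (- (c 4 6 / L t) / (2 * P t) - (c 3 6 - c 4 6 * T t) * D t / (2 * (P t)^2))) (at t)"
    proof -
      have "((\<lambda>t. c 3 6 - c 4 6 * T t) has_real_derivative - c 4 6 * (h t / L t)) (at t)"
        "((\<lambda>t. 2 * P t) has_real_derivative 2 * (h t * D t)) (at t)"
        using dT[OF t] dP by (auto intro!: derivative_eq_intros)
      from DERIV_divide[OF this] sol(1)[OF t]
      have "(y has_real_derivative (- c 4 6 * (h t / L t) * (2 * P t)
          - (c 3 6 - c 4 6 * T t) * (2 * (h t * D t))) / (2 * P t * (2 * P t))) (at t)"
        by (simp add: y_def)
      moreover have "(- c 4 6 * (h t / L t) * (2 * P t)
          - (c 3 6 - c 4 6 * T t) * (2 * (h t * D t))) / (2 * P t * (2 * P t)) =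
        h t * (- (c 4 6 / L t) / (2 * P t) - (c 3 6 - c 4 6 * T t) * D t / (2 * (P t)^2))"
        using sol(1)[OF t] L[OF t] by (simp add: power2_eq_square field_simps)
      ultimately show ?thesis by simp
    qed
    have dz: "(z has_real_derivative h t * m1 / (L t * \<gamma>^2)) (at t)"
      unfolding z_def using dT[OF t] L[OF t] \<gamma>0
      by (auto intro!: derivative_eq_intros simp: field_simps)
    \<comment> \<open>The ratios \<open>b12/b11\<close>, \<open>b15/b11\<close>, \<open>b25/b22\<close> are explicit functions of \<open>\<theta>\<close>, so each
       numerator is differentiated by the product rule.\<close>
    have prod: "deriv b t = f' * b' t + f t * deriv b' t"
      if b: "\<And>s. s \<in> I \<Longrightarrow> b s = f s * b' s" and "(f has_real_derivative f') (at t)"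
        "(b has_real_derivative deriv b t) (at t)" "(b' has_real_derivative deriv b' t) (at t)"
      for b b' f f'
    proof (rule DERIV_unique[OF that(3)])
      show "(b has_real_derivative f' * b' t + f t * deriv b' t) (at t)"
        by (rule has_field_derivative_transform_within_open[OF _ I t b[symmetric]])
          (use DERIV_mult[OF that(2,4)] in \<open>simp_all add: algebra_simps\<close>)
    qed
    note b' = db[OF t t t t]
    have bx: "b12 s = x s * b11 s" and by': "b15 s = y s * b11 s" and bz: "b25 s = z s * b22 s"
      if "s \<in> I" for s
      using sol(2-4)[OF that] by (simp_all add: x_def y_def z_def)
    show "rot_vec R t $ 3 = - \<gamma> / (b11 t)^2" "rot_vec R t $ 2 = 0" "rot_vec R t $ 1 = 0"
      using rotation_of_B_form_solution[OF CS defs(1) L[OF t] defs(2) \<gamma>[OF t] \<gamma>0 \<gamma>2 defs(3)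
        sol(1)[OF t] defs(4) m1 sol(5)[OF t] G(1)[OF t, unfolded g11_def] b35[OF t]
        fun_cong[OF x_def] bx[OF t] prod[OF bx dx b'(2,1)] refl
        fun_cong[OF y_def] by'[OF t] prod[OF by' dy b'(4,1)] refl
        fun_cong[OF z_def] bz[OF t] prod[OF bz dz b'(5,3)] refl
        Q(1)[OF t, folded c0_def, unfolded q12_def] fun_cong[OF q1_def] M(1)[OF t]
        fun_cong[OF q2_def] M(2)[OF t]]
      by blast+
  qed
  have d0: "(c 3 6 ^ 2 + c 4 6 ^ 2) * \<gamma>^2 + 4 * c 1 2 * d + 4 * m0^2 + 4 * m1^2 = 0"
    using m_identities(1,2)[OF \<gamma>2 m0 m1, folded d_def] by (simp add: c0_def algebra_simps)
  have "0 < (c 3 6 ^ 2 + c 4 6 ^ 2) * \<gamma>^2"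
    using assms(18) \<gamma>0 by (auto simp: sum_power2_gt_zero_iff)
  with d0 zero_le_power2[of m0] zero_le_power2[of m1] have "4 * c 1 2 * d < 0"
    by linarith
  then have "d \<noteq> 0"
    by auto
  have ms: "(\<gamma>^2 * (c 3 6)^2 + 4 * m0^2) / d = 2 * (a - c0)"
    "(\<gamma>^2 * (c 4 6)^2 + 4 * m1^2) / d = - 2 * (a + c0)"
    "(\<gamma>^2 * c 3 6 * c 4 6 - 4 * m0 * m1) / d = - 2 * s"
    unfolding m_identities[OF \<gamma>2 m0 m1, folded d_def] using \<open>d \<noteq> 0\<close> by simp_all
  define \<beta> where "\<beta> = (\<lambda>t. (c 3 6 * sin (\<theta> t) - c 4 6 * (1 - cos (\<theta> t))) / (2 * \<gamma> * sin (\<theta> t)) * b22 t)"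
  have b22: "b22 t = \<gamma> / (b11 t * h t)" if t: "t \<in> I" for t
    using \<gamma>[OF t] nz[OF t] by (simp add: field_simps)
  have b15: "b15 t = \<beta> t" if t: "t \<in> I" and "sin (\<theta> t) \<noteq> 0" for t
  proof -
    have S: "S t \<noteq> 0" using that by (simp add: S_def)
    have "T t * S t = 1 - C t"
      using CS[of t] L[OF t] unfolding T_def L_def by (simp add: field_simps power2_eq_square)
    then have "c 3 6 * S t - c 4 6 * (1 - C t) = (c 3 6 - c 4 6 * T t) * S t"
      by algebra
    then have "(c 3 6 * S t - c 4 6 * (1 - C t)) / (2 * \<gamma> * S t) = (c 3 6 - c 4 6 * T t) / (2 * \<gamma>)"
      using S by simp
    then have \<beta>: "\<beta> t = (c 3 6 - c 4 6 * T t) / (2 * \<gamma>) * b22 t"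
      by (simp only: \<beta>_def S_def C_def)
    have b: "b11 t / P t = b22 t / \<gamma>"
      using b22[OF t] \<gamma>0 nz[OF t] G(1)[OF t, symmetric]
      by (simp add: g11_def field_simps power2_eq_square)
    have "b15 t = (c 3 6 - c 4 6 * T t) / 2 * (b11 t / P t)"
      using sol(3)[OF t] by simp
    then show ?thesis
      unfolding b \<beta> by simp
  qed
  have b15_lim: "cos (\<theta> t) = 1 \<and> (\<beta> \<longlongrightarrow> b15 t) (at t)" if t: "t \<in> I" and S0: "sin (\<theta> t) = 0" for t
  proof
    show C1: "cos (\<theta> t) = 1"
      using L[OF t] S0 sin_zero_abs_cos_one[OF S0] by (auto simp: L_def C_def abs_if split: if_splits)
    \<comment> \<open>Zeros of \<open>sin \<theta>\<close> are isolated because \<open>\<theta>' \<noteq> 0\<close>, so the formula for \<open>b15\<close> holds in a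
       punctured neighbourhood and passes to the limit.\<close>
    have "h t * C t \<noteq> 0" using C1 nz[OF t] by (simp add: C_def)
    with dS[OF t] have "\<forall>\<^sub>F s in at t. (S s - S t) / (s - t) \<noteq> 0"
      unfolding has_field_derivative_iff by (rule tendsto_imp_eventually_ne)
    then have "\<forall>\<^sub>F s in at t. S s \<noteq> S t"
      by eventually_elim auto
    moreover have "\<forall>\<^sub>F s in at t. s \<in> I"
      using I t by (simp add: eventually_at_topological) blast
    ultimately have "\<forall>\<^sub>F s in at t. b15 s = \<beta> s"
      by eventually_elim (use S0 b15 in \<open>simp add: S_def\<close>)
    moreover have "(b15 \<longlongrightarrow> b15 t) (at t)"
      using DERIV_isCont[OF db(4)[OF t t t t]] by (simp add: isCont_def)
    ultimately show "(\<beta> \<longlongrightarrow> b15 t) (at t)"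
      by (rule Lim_transform_eventually[rotated])
  qed
  show ?thesis
  proof (rule exI[of _ m0], rule exI[of _ m1],
      unfold Let_def d_def[symmetric] ms \<beta>_def[symmetric] h_def[symmetric], intro conjI ballI)
    show "((c 3 6)^2 + (c 4 6)^2) * \<gamma>^2 + 4 * c 1 2 * (c 4 6 * m0 + c 3 6 * m1)
      + 4 * m0^2 + 4 * m1^2 = 0"
      using d0 by (simp add: d_def algebra_simps)
    show "d \<noteq> 0" by fact
  next
    fix t assume t: "t \<in> I"
    show "if sin (\<theta> t) = 0 then cos (\<theta> t) = 1 \<and> (\<beta> \<longlongrightarrow> b15 t) (at t) else b15 t = \<beta> t"
      using b15[OF t] b15_lim[OF t] by simp
    have "(m1 * S t + m0 * L t) / (\<gamma>^2 * L t) = (m1 * T t + m0) / \<gamma>^2"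
      using L[OF t] by (simp add: T_def field_simps)
    then show "b25 t = (m1 * sin (\<theta> t) + m0 * (1 + cos (\<theta> t))) / (\<gamma>^2 * (1 + cos (\<theta> t))) * b22 t"
      using sol(4)[OF t] by (simp add: S_def L_def C_def)
    show "(h t)^3 = 4 * (c 5 6 * \<gamma>^2 - c 3 6 * m1 - c 4 6 * m0) * (1 + cos (\<theta> t))"
      using sol(7)[OF t] by (simp add: d_def L_def C_def diff_diff_eq)
    show "b35 t = - h t / (2 * \<gamma> * (1 + cos (\<theta> t)))"
      using sol(6)[OF t] by (simp add: L_def C_def)
    show "(b11 t)^2 = ((2 * (a - c0) - - 2 * (a + c0)) * cos (\<theta> t) - 2 * (- 2 * s) * sin (\<theta> t)
        + 2 * (a - c0) + - 2 * (a + c0)) / (4 * h t)"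
      using G(1)[OF t] nz[OF t] by (simp add: g11_def P_def C_def S_def field_simps)
    show "b12 t = ((2 * (a - c0) - - 2 * (a + c0)) * sin (\<theta> t) + 2 * (- 2 * s) * cos (\<theta> t))
        / (4 * b11 t * h t)"
      using G(2)[OF t] nz[OF t] by (simp add: g12_def D_def C_def S_def field_simps)
    show "b22 t = \<gamma> / (b11 t * h t)" by (rule b22[OF t])
    show "rot_vec R t $ 1 = 0" "rot_vec R t $ 2 = 0" "rot_vec R t $ 3 = - \<gamma> / (b11 t)^2"
      by (rule w[OF t])+
  qed
qed

end
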